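(* For any $n \geq 0$, the set of twin Tamari diagrams of size $n$ is in bijection with the set of pairs of twin binary trees with $n$ nodes. Moreover, this bijection is expressed as follows: if $J = (T_L, T_R)$ is a pair of twin binary trees, the twin Tamari diagram in bijection with $J$ is $\mathrm{ttd}(J) := (\mathrm{td}(T_L), \mathrm{td}(T_R))$.
   Context: A binary tree is either a leaf (empty tree) or a node with a left and a right binary subtree. The inorder traversal visits recursively the left subtree, then the root, then the right subtree. The canopy of a binary tree with $n$ nodes is the word of length $n-1$ on $\{0,1\}$ obtained by reading its leaves from left to right except the first and the last one, writing $0$ if the leaf is a right child and $1$ if it is a left child. A pair of twin binary trees (with $n$ nodes) is a pair $(T_L,T_R)$ of binary trees with $n$ nodes each whose canopies differ at every position $1 \leq i \leq n-1$. The Tamari diagram $\mathrm{td}(T)$ of a binary tree $T$ with $n$ nodes is the word of length $n$ whose $i$-th letter is the number of nodes in the right subtree of the $i$-th node of $T$ in inorder; a Tamari diagram of length $n$ is a word of this form. (The Tamari diagrams of length $n$ are exactly the words $\delta$ of nonnegative integers with $0 \leq \delta_i \leq n-i$ for $1\le i \le n$ and $\delta_{i+j} \leq \delta_i - j$ for $1\le i\le n$, $1 \leq j \leq \delta_i$, and $\mathrm{td}$ is a bijection from binary trees with $n$ nodes to them.) A twin Tamari diagram of size $n$ is a pair $(\delta^L,\delta^R)$ of Tamari diagrams of length $n$ such that for every $1 \leq i \leq n-1$, exactly one letter among $\delta^L_i$ and $\delta^R_i$ is zero. *)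

theory Defs
  imports "HOL-Library.Tree"
begin

type_synonym bintree = "unit tree"

text \<open>The subtrees rooted at the (internal) nodes, listed in the inorder of their roots.\<close>

fun inorder_subtrees :: "'a tree \<Rightarrow> 'a tree list" where
  "inorder_subtrees Leaf = []"
| "inorder_subtrees (Node l x r) = inorder_subtrees l @ [Node l x r] @ inorder_subtrees r"

text \<open>One letter per leaf, from left to right: 0 for a right child and 1 for a left child. The
  parameter \<open>b\<close> records which kind of child the tree itself is.\<close>

fun leaf_word :: "nat \<Rightarrow> 'a tree \<Rightarrow> nat list" where
  "leaf_word b Leaf = [b]"
| "leaf_word b (Node l x r) = leaf_word 1 l @ leaf_word 0 r"

text \<open>The first and the last letter are dropped. The initial parameter 0 is a dummy: it is only
  written when the whole tree is a leaf, and that letter is dropped. The canopy of the empty tree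
  is thus the empty word.\<close>

definition canopy :: "'a tree \<Rightarrow> nat list" where
  "canopy t = butlast (tl (leaf_word 0 t))"

text \<open>Letters of words are numbered from 0 by \<open>(!)\<close>, so the positions \<open>1 \<le> i \<le> n - 1\<close> of the
  usual 1-based numbering become \<open>i < n - 1\<close>; there are none for \<open>n = 0\<close>.\<close>

definition twin_binary_trees :: "nat \<Rightarrow> (bintree \<times> bintree) set" where
  "twin_binary_trees n = {(tL, tR). size tL = n \<and> size tR = n \<and>
     (\<forall>i < n - 1. canopy tL ! i \<noteq> canopy tR ! i)}"

definition td :: "bintree \<Rightarrow> nat list" where
  "td t = map (\<lambda>s. size (right s)) (inorder_subtrees t)"

definition tamari_diagrams :: "nat \<Rightarrow> nat list set" where
  "tamari_diagrams n = td ` {t. size t = n}"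

text \<open>Exactly one of the two letters is zero, written as an exclusive or.\<close>

definition twin_tamari_diagrams :: "nat \<Rightarrow> (nat list \<times> nat list) set" where
  "twin_tamari_diagrams n = {(dL, dR). dL \<in> tamari_diagrams n \<and> dR \<in> tamari_diagrams n \<and>
     (\<forall>i < n - 1. (dL ! i = 0) \<noteq> (dR ! i = 0))}"

definition ttd :: "bintree \<times> bintree \<Rightarrow> nat list \<times> nat list" where
  "ttd J = (td (fst J), td (snd J))"

end

theory Submission
  imports Defs
begin

text \<open>For \<open>0 < i < n\<close>, the leaf between the nodes \<open>i\<close> and \<open>i + 1\<close> in inorder is the right child
  of the former if its right subtree is empty, and otherwise the left child of the latter. Hence the
  canopy is the word recording which letters of the Tamari diagram are nonzero, and the two
  twin conditions coincide. A tree is recovered from its Tamari diagram because the root is the first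
  node whose letter is as large as its position allows: a node of the left subtree has its
  right subtree inside that left subtree.\<close>

lemma td_Leaf [simp]: "td Leaf = []"
  by (simp add: td_def)

lemma td_Node [simp]: "td (Node l x r) = td l @ size r # td r"
  by (simp add: td_def)

lemma length_td [simp]: "length (td t) = size t"
  by (induction t) simp_all

text \<open>The letter counts nodes that all come after position \<open>i\<close> in
  inorder.\<close>

lemma td_nth_bound: "i < size t \<Longrightarrow> i + td t ! i < size t"
proof (induction t arbitrary: i)
  case (Node l x r)
  consider "i < size l" | "i = size l" | j where "i = Suc (size l + j)" "j < size r"
  proof (cases "size l < i")
    case True
    then obtain j where "i = Suc (size l + j)" by (auto simp: less_iff_Suc_add)
    then show ?thesis using that(3)[of j] Node.prems by simp
  qed (use that(1,2) in linarith)
  then show ?case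
  proof cases
    case 1
    then show ?thesis using Node.IH(1)[of i] by (simp add: nth_append)
  next
    case 2
    then show ?thesis by (simp add: nth_append)
  next
    case 3
    then show ?thesis using Node.IH(2)[of j] by (simp add: nth_append)
  qed
qed simp

lemma td_Node_eq_imp_size_left_le:
  assumes "td (Node l x r) = td (Node l' x' r')"
  shows "size l' \<le> size l"
proof (rule ccontr)
  assume "\<not> size l' \<le> size l"
  then have less: "size l < size l'" by simp
  \<comment> \<open>Position \<open>size l\<close> is the root of the first tree but lies inside
    \<open>l'\<close> in the second.\<close>
  have "size r = td (Node l x r) ! size l" by (simp add: nth_append)
  also have "\<dots> = td l' ! size l" using assms less by (simp add: nth_append)
  finally have "size l + size r < size l'" using td_nth_bound[OF less] by simp
  moreover have "size (Node l x r) = size (Node l' x' r')"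
    using arg_cong[OF assms, of length] by (simp only: length_td)
  ultimately show False by simp
qed

lemma td_inject: "td s = td t \<Longrightarrow> s = t"
proof (induction s arbitrary: t)
  case Leaf
  then show ?case by (cases t) simp_all
next
  case (Node l x r)
  then obtain l' x' r' where t: "t = Node l' x' r'" by (cases t) simp_all
  \<comment> \<open>By symmetry of the size bound; both words then split at the same root
    position.\<close>
  have "size l = size l'"
    using td_Node_eq_imp_size_left_le Node.prems t by (metis order_antisym)
  then have "td l = td l'" "td r = td r'" using Node.prems t by simp_all
  then show ?case using Node.IH t by simp
qed

text \<open>Each node determines the letter of the leaf just after it. Only the leftmost leaf
  remains: a left child, unless it is the whole tree.\<close>

lemma leaf_word_conv_td:
  "leaf_word b t = (if t = Leaf then b else 1) # map (\<lambda>k. of_bool (k \<noteq> 0)) (td t)"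
  by (induction t arbitrary: b) simp_all

lemma canopy_nth:
  assumes "i < size t - 1"
  shows "canopy t ! i = of_bool (td t ! i \<noteq> 0)"
  \<comment> \<open>Dropping the leftmost leaf aligns the indices of the two words.\<close>
  using assms by (simp add: canopy_def leaf_word_conv_td nth_butlast)

theorem proposition5p3:
  fixes n :: nat
  shows "bij_betw ttd (twin_binary_trees n) (twin_tamari_diagrams n)"
proof (rule bij_betw_imageI)
  show "inj_on ttd (twin_binary_trees n)"
    by (auto simp: inj_on_def ttd_def dest: td_inject)
  have twin_iff: "(tL, tR) \<in> twin_binary_trees n \<longleftrightarrow>
      size tL = n \<and> size tR = n \<and> (\<forall>i < n - 1. (td tL ! i = 0) \<noteq> (td tR ! i = 0))" for tL tR
    by (auto simp: twin_binary_trees_def canopy_nth of_bool_eq_iff simp del: neq0_conv)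
  show "ttd ` twin_binary_trees n = twin_tamari_diagrams n"
  proof
    show "ttd ` twin_binary_trees n \<subseteq> twin_tamari_diagrams n"
      by (auto simp: twin_iff ttd_def twin_tamari_diagrams_def tamari_diagrams_def)
    show "twin_tamari_diagrams n \<subseteq> ttd ` twin_binary_trees n"
    proof
      fix d assume d: "d \<in> twin_tamari_diagrams n"
      then obtain tL tR where "d = (td tL, td tR)" "size tL = n" "size tR = n"
        by (auto simp: twin_tamari_diagrams_def tamari_diagrams_def)
      with d have "d = ttd (tL, tR)" "(tL, tR) \<in> twin_binary_trees n"
        by (simp_all add: ttd_def twin_iff twin_tamari_diagrams_def)
      then show "d \<in> ttd ` twin_binary_trees n" by (rule image_eqI)
    qed
  qed
qed

end
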